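(* Let $\mathcal C$ be a category and let $(\alpha,X)$ be a categorical partial action of $\mathcal C$ on a set $X$. Let $(\iota,\beta,E)$ be the universal globalization of $(\alpha,X)$ as a partial semigroupoid action, and let $(i,\gamma,Y)$ be the universal globalization of $(\alpha,X)$ as a partial category action (both constructed explicitly in the context). Then $(\beta,E)$ and $(\gamma,Y)$ are isomorphic in the category $\mathcal A(\mathcal C)$ of global semigroupoid actions of $\mathcal C$.
   Context: A category is small, identified with its set of morphisms $\mathcal C$; objects are identified with identity morphisms, $\mathcal C_0\subseteq\mathcal C$; $D,R\colon\mathcal C\to\mathcal C_0$ are domain and range; $gh$ is defined iff $D(g)=R(h)$. It is regarded as a semigroupoid with $\mathcal C^{(2)}=\{(g,h):D(g)=R(h)\}$. Put $\mathcal C^g=\{h:(g,h)\in\mathcal C^{(2)}\}$. A partial (semigroupoid) action of $\mathcal C$ on $X$ is a pair $\alpha=(\{{_gX}\}_{g\in\mathcal C},\{\alpha_g\}_{g\in\mathcal C})$ of subsets ${_gX}\subseteq X$ and functions $\alpha_g\colon{_gX}\to X$, with $X_g:=\alpha_g({_gX})$, such that for all $(g,h)\in\mathcal C^{(2)}$: (P1) $\alpha_h^{-1}({_gX}\cap X_h)={_hX}\cap{_{gh}X}$; (P2) $\alpha_g(\alpha_h(x))=\alpha_{gh}(x)$ for $x\in{_hX}\cap{_{gh}X}$. It is global if moreover (G1) $\mathcal C^g=\mathcal C^h\neq\emptyset$ implies ${_gX}={_hX}$, and (G2) $(g,h)\in\mathcal C^{(2)}$ implies ${_hX}={_{gh}X}$.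 It is categorical if (C1) $X=\bigcup_{g\in\mathcal C}X_g$; (C2) $\alpha_e=\mathrm{id}_{{_eX}}$ for all $e\in\mathcal C_0$; (C3) if $e\in\mathcal C_0$ and $(g,e)\in\mathcal C^{(2)}$ then ${_gX}\subseteq{_eX}$. A morphism of partial actions $\varphi\colon(\alpha,X)\to(\beta,Y)$ is a function with $\varphi({_gX})\subseteq{_gY}$ and $\varphi(\alpha_g(x))=\beta_g(\varphi(x))$ for all $g$ and $x\in{_gX}$. $\mathcal A(\mathcal C)$ is the category of global actions of $\mathcal C$ with these morphisms. Construction of $(\iota,\beta,E)$. For $s,t\in\mathcal C$ write $s\sim t$ if $s=t$, or $\mathcal C^s=\mathcal C^t\neq\emptyset$, or $s=ut$ for some $u$ with $(u,t)\in\mathcal C^{(2)}$. Let $R'$ be the smallest equivalence relation containing $\sim$, $\rho_s$ the class of $s$, and ${_{\rho_s}X}=\bigcup_{tR's}{_tX}\cup\bigcup_{t\in\mathcal C^s}X_t$. Let $\delta\notin\mathcal C$ and $\mathcal D=\{(s,x)\in\mathcal C\times X:x\in{_{\rho_s}X}\}\cup\{(\delta,x):x\in X\}$. Let $\approx$ be the smallest equivalence relation on $\mathcal D$ such that (1) $(\delta,y)\approx(s,x)$ whenever $x\in{_sX}$, $\alpha_s(x)=y$; (2) $(s,x)\approx(t,y)$ whenever there is $u\in\mathcal C^t$ with $s=tu$, $x\in{_uX}$, $\alpha_u(x)=y$. Let $E=\mathcal D/{\approx}$ with classes $[a,x]$. ${_sE}$ is the set of classes of elements of $\{(a,x)\in\mathcal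 D:(a,x)\approx(t,y)\text{ for some }(t,y)\in\mathcal D,\ t\in\mathcal C^s\}\cup\{(\delta,x):x\in{_{\rho_s}X}\}$; $\beta_s\colon{_sE}\to E$ is $\beta_s([a,x])=[st,y]$ if $(a,x)\approx(t,y)$ with $t\in\mathcal C^s$, and $\beta_s([\delta,x])=[s,x]$ if $x\in{_{\rho_s}X}$ (well defined); $\iota(x)=[\delta,x]$. Then $(\beta,E)$ is a global action, $\iota$ is a morphism, and every morphism from $(\alpha,X)$ to a global action factors uniquely through $\iota$. Construction of $(i,\gamma,Y)$ (Nystedt). Let $\overline X=\{(g,x)\in\mathcal C\times X:x\in{_{D(g)}X}\}$ and let $\simeq$ be the smallest equivalence relation on $\overline X$ with $(g,x)\simeq(g',x')$ whenever either there is $h\in\mathcal C$ with $g'h$ defined, $g'h=g$, $x\in{_hX}$ and $\alpha_h(x)=x'$; or $x=x'$ and $g,g'\in\mathcal C_0$. Let $Y=\overline X/{\simeq}$. For $g\in\mathcal C$, ${_gY}$ is the set of classes of those $(h,x)\in\overline X$ with $(h,x)\simeq(h',x')$ for some $(h',x')\in\overline X$ such that $gh'$ is defined, and $\gamma_g([h,x])=[gh',x']$. For $x\in X$ choose $e\in\mathcal C_0$ with $x\in{_eX}$ and set $i(x)=[e,x]$. This is a well-defined global action, and $i$ is a morphism. *)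

theory Defs
  imports Main
begin

section \<open>Small categories, identified with their sets of morphisms\<close>

record 'c category =
  Mor :: "'c set"
  Obj :: "'c set"
  Dom :: "'c \<Rightarrow> 'c"
  Rng :: "'c \<Rightarrow> 'c"
  Comp :: "'c \<Rightarrow> 'c \<Rightarrow> 'c" (infixl "\<cdot>\<index>" 70)

text \<open>Composition is written in the order of functions: \<open>g \<cdot> h\<close> is defined iff \<open>Dom g = Rng h\<close>.
  Objects are the identity morphisms.\<close>

locale small_category =
  fixes C :: "'c category" (structure)
  assumes Obj_subset: "Obj C \<subseteq> Mor C"
    and Dom_in: "g \<in> Mor C \<Longrightarrow> Dom C g \<in> Obj C"
    and Rng_in: "g \<in> Mor C \<Longrightarrow> Rng C g \<in> Obj C"
    and Dom_Obj: "e \<in> Obj C \<Longrightarrow> Dom C e = e"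
    and Rng_Obj: "e \<in> Obj C \<Longrightarrow> Rng C e = e"
    and Comp_in: "\<lbrakk>g \<in> Mor C; h \<in> Mor C; Dom C g = Rng C h\<rbrakk> \<Longrightarrow> g \<cdot> h \<in> Mor C"
    and Dom_Comp: "\<lbrakk>g \<in> Mor C; h \<in> Mor C; Dom C g = Rng C h\<rbrakk> \<Longrightarrow> Dom C (g \<cdot> h) = Dom C h"
    and Rng_Comp: "\<lbrakk>g \<in> Mor C; h \<in> Mor C; Dom C g = Rng C h\<rbrakk> \<Longrightarrow> Rng C (g \<cdot> h) = Rng C g"
    and Comp_assoc: "\<lbrakk>g \<in> Mor C; h \<in> Mor C; k \<in> Mor C; Dom C g = Rng C h; Dom C h = Rng C k\<rbrakk>
          \<Longrightarrow> (g \<cdot> h) \<cdot> k = g \<cdot> (h \<cdot> k)"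
    and Comp_Dom: "g \<in> Mor C \<Longrightarrow> g \<cdot> Dom C g = g"
    and Rng_Comp_self: "g \<in> Mor C \<Longrightarrow> Rng C g \<cdot> g = g"

definition composable :: "('c, 'm) category_scheme \<Rightarrow> ('c \<times> 'c) set" where
  "composable C = {(g, h). g \<in> Mor C \<and> h \<in> Mor C \<and> Dom C g = Rng C h}"

text \<open>\<open>right_mult C g\<close> is the set $\mathcal C^g$ of all \<open>h\<close> for which \<open>g \<cdot> h\<close> is defined.\<close>

definition right_mult :: "('c, 'm) category_scheme \<Rightarrow> 'c \<Rightarrow> 'c set" where
  "right_mult C g = {h. (g, h) \<in> composable C}"


section \<open>Partial actions\<close>

text \<open>\<open>adom A g\<close> is ${_gX}$; the values of \<open>act A g\<close> outside \<open>adom A g\<close> (and everything indexed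
  by elements outside \<open>Mor C\<close>) are irrelevant.\<close>

record ('c, 'x) action =
  space :: "'x set"
  adom :: "'c \<Rightarrow> 'x set"
  act :: "'c \<Rightarrow> 'x \<Rightarrow> 'x"

definition aran :: "('c, 'x) action \<Rightarrow> 'c \<Rightarrow> 'x set" where
  "aran A g = act A g ` adom A g"

definition partial_action :: "'c category \<Rightarrow> ('c, 'x) action \<Rightarrow> bool" where
  "partial_action C A \<longleftrightarrow>
     (\<forall>g\<in>Mor C. adom A g \<subseteq> space A \<and> aran A g \<subseteq> space A) \<and>
     (\<forall>(g, h)\<in>composable C.
        {x \<in> adom A h. act A h x \<in> adom A g \<inter> aran A h} = adom A h \<inter> adom A (g \<cdot>\<^bsub>C\<^esub> h)) \<and>
     (\<forall>(g, h)\<in>composable C. \<forall>x\<in>adom A h \<inter> adom A (g \<cdot>\<^bsub>C\<^esub> h).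
        act A g (act A h x) = act A (g \<cdot>\<^bsub>C\<^esub> h) x)"

definition global_action :: "'c category \<Rightarrow> ('c, 'x) action \<Rightarrow> bool" where
  "global_action C A \<longleftrightarrow> partial_action C A \<and>
     (\<forall>g\<in>Mor C. \<forall>h\<in>Mor C.
        right_mult C g = right_mult C h \<and> right_mult C h \<noteq> {} \<longrightarrow> adom A g = adom A h) \<and>
     (\<forall>(g, h)\<in>composable C. adom A h = adom A (g \<cdot>\<^bsub>C\<^esub> h))"

definition categorical_partial_action :: "'c category \<Rightarrow> ('c, 'x) action \<Rightarrow> bool" where
  "categorical_partial_action C A \<longleftrightarrow> partial_action C A \<and>
     space A = (\<Union>g\<in>Mor C. aran A g) \<and>
     (\<forall>e\<in>Obj C. \<forall>x\<in>adom A e. act A e x = x) \<and>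
     (\<forall>e\<in>Obj C. \<forall>g. (g, e) \<in> composable C \<longrightarrow> adom A g \<subseteq> adom A e)"

definition action_morphism ::
    "'c category \<Rightarrow> ('c, 'x) action \<Rightarrow> ('c, 'y) action \<Rightarrow> ('x \<Rightarrow> 'y) \<Rightarrow> bool" where
  "action_morphism C A B \<phi> \<longleftrightarrow>
     \<phi> ` space A \<subseteq> space B \<and>
     (\<forall>g\<in>Mor C. \<phi> ` adom A g \<subseteq> adom B g \<and> (\<forall>x\<in>adom A g. \<phi> (act A g x) = act B g (\<phi> x)))"

text \<open>Isomorphism in the category of global actions of \<open>C\<close>: both actions are objects of that
  category, and there are mutually inverse morphisms between them.\<close>

definition isomorphic_global_actions ::
    "'c category \<Rightarrow> ('c, 'x) action \<Rightarrow> ('c, 'y) action \<Rightarrow> bool" where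
  "isomorphic_global_actions C A B \<longleftrightarrow>
     global_action C A \<and> global_action C B \<and>
     (\<exists>\<phi> \<psi>. action_morphism C A B \<phi> \<and> action_morphism C B A \<psi> \<and>
        (\<forall>x\<in>space A. \<psi> (\<phi> x) = x) \<and> (\<forall>y\<in>space B. \<phi> (\<psi> y) = y))"


section \<open>Generated equivalence relations\<close>

definition least_equiv :: "'a set \<Rightarrow> ('a \<times> 'a) set \<Rightarrow> ('a \<times> 'a) set" where
  "least_equiv S G = \<Inter>{r. equiv S r \<and> G \<subseteq> r}"

text \<open>This is the intended relation only if \<open>G \<subseteq> S \<times> S\<close>; all generating relations below
  satisfy this by definition.\<close>


section \<open>The universal globalization as a partial semigroupoid action\<close>

definition sg_gen :: "'c category \<Rightarrow> ('c \<times> 'c) set" where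
  "sg_gen C = {(s, t). s \<in> Mor C \<and> t \<in> Mor C \<and>
     (s = t \<or> (right_mult C s = right_mult C t \<and> right_mult C t \<noteq> {}) \<or>
      (\<exists>u. (u, t) \<in> composable C \<and> s = u \<cdot>\<^bsub>C\<^esub> t))}"

definition sg_rel :: "'c category \<Rightarrow> ('c \<times> 'c) set" where
  "sg_rel C = least_equiv (Mor C) (sg_gen C)"

text \<open>\<open>rho_dom C A s\<close> is ${_{\rho_s}X}$.\<close>

definition rho_dom :: "'c category \<Rightarrow> ('c, 'x) action \<Rightarrow> 'c \<Rightarrow> 'x set" where
  "rho_dom C A s = (\<Union>t\<in>{t. (t, s) \<in> sg_rel C}. adom A t) \<union> (\<Union>t\<in>right_mult C s. aran A t)"

text \<open>The new symbol $\delta \notin \mathcal C$ is \<open>None\<close>; \<open>s \<in> Mor C\<close> is represented by \<open>Some s\<close>.\<close>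

definition sg_pairs :: "'c category \<Rightarrow> ('c, 'x) action \<Rightarrow> ('c option \<times> 'x) set" where
  "sg_pairs C A = {(Some s, x) | s x. s \<in> Mor C \<and> x \<in> rho_dom C A s} \<union>
     {(None, x) | x. x \<in> space A}"

definition sg_approx_gen ::
    "'c category \<Rightarrow> ('c, 'x) action \<Rightarrow> (('c option \<times> 'x) \<times> ('c option \<times> 'x)) set" where
  "sg_approx_gen C A = (sg_pairs C A \<times> sg_pairs C A) \<inter>
     ({((None, y), (Some s, x)) | s x y. s \<in> Mor C \<and> x \<in> adom A s \<and> act A s x = y} \<union>
      {((Some s, x), (Some t, y)) | s t x y. t \<in> Mor C \<and>
         (\<exists>u\<in>right_mult C t. s = t \<cdot>\<^bsub>C\<^esub> u \<and> x \<in> adom A u \<and> act A u x = y)})"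

definition sg_approx ::
    "'c category \<Rightarrow> ('c, 'x) action \<Rightarrow> (('c option \<times> 'x) \<times> ('c option \<times> 'x)) set" where
  "sg_approx C A = least_equiv (sg_pairs C A) (sg_approx_gen C A)"

definition sg_class ::
    "'c category \<Rightarrow> ('c, 'x) action \<Rightarrow> 'c option \<times> 'x \<Rightarrow> ('c option \<times> 'x) set" where
  "sg_class C A p = sg_approx C A `` {p}"

definition sg_space :: "'c category \<Rightarrow> ('c, 'x) action \<Rightarrow> ('c option \<times> 'x) set set" where
  "sg_space C A = sg_pairs C A // sg_approx C A"

definition sg_adom ::
    "'c category \<Rightarrow> ('c, 'x) action \<Rightarrow> 'c \<Rightarrow> ('c option \<times> 'x) set set" where
  "sg_adom C A s = sg_class C A `
     ({p \<in> sg_pairs C A. \<exists>t y. (Some t, y) \<in> sg_pairs C A \<and> t \<in> right_mult C s \<and>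
          (p, (Some t, y)) \<in> sg_approx C A} \<union>
      {(None, x) | x. x \<in> rho_dom C A s})"

text \<open>The definite description expresses that the value is independent of representatives.\<close>

definition sg_act ::
    "'c category \<Rightarrow> ('c, 'x) action \<Rightarrow> 'c \<Rightarrow> ('c option \<times> 'x) set \<Rightarrow> ('c option \<times> 'x) set" where
  "sg_act C A s \<epsilon> = (THE \<epsilon>'.
     (\<exists>p t y. p \<in> sg_pairs C A \<and> \<epsilon> = sg_class C A p \<and>
        (Some t, y) \<in> sg_pairs C A \<and> t \<in> right_mult C s \<and> (p, (Some t, y)) \<in> sg_approx C A \<and>
        \<epsilon>' = sg_class C A (Some (s \<cdot>\<^bsub>C\<^esub> t), y)) \<or>
     (\<exists>x\<in>rho_dom C A s. \<epsilon> = sg_class C A (None, x) \<and> \<epsilon>' = sg_class C A (Some s, x)))"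

definition sg_globalization :: "'c category \<Rightarrow> ('c, 'x) action \<Rightarrow> ('c, ('c option \<times> 'x) set) action"
  where
  "sg_globalization C A = \<lparr>space = sg_space C A, adom = sg_adom C A, act = sg_act C A\<rparr>"

definition sg_iota :: "'c category \<Rightarrow> ('c, 'x) action \<Rightarrow> 'x \<Rightarrow> ('c option \<times> 'x) set" where
  "sg_iota C A x = sg_class C A (None, x)"


section \<open>The universal globalization as a partial category action\<close>

definition cat_pairs :: "'c category \<Rightarrow> ('c, 'x) action \<Rightarrow> ('c \<times> 'x) set" where
  "cat_pairs C A = {(g, x). g \<in> Mor C \<and> x \<in> adom A (Dom C g)}"

definition cat_equiv_gen ::
    "'c category \<Rightarrow> ('c, 'x) action \<Rightarrow> (('c \<times> 'x) \<times> ('c \<times> 'x)) set" where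
  "cat_equiv_gen C A = (cat_pairs C A \<times> cat_pairs C A) \<inter>
     ({((g, x), (g', x')) | g x g' x'. \<exists>h. (g', h) \<in> composable C \<and> g' \<cdot>\<^bsub>C\<^esub> h = g \<and>
         x \<in> adom A h \<and> act A h x = x'} \<union>
      {((g, x), (g', x')) | g x g' x'. x = x' \<and> g \<in> Obj C \<and> g' \<in> Obj C})"

definition cat_equiv ::
    "'c category \<Rightarrow> ('c, 'x) action \<Rightarrow> (('c \<times> 'x) \<times> ('c \<times> 'x)) set" where
  "cat_equiv C A = least_equiv (cat_pairs C A) (cat_equiv_gen C A)"

definition cat_class ::
    "'c category \<Rightarrow> ('c, 'x) action \<Rightarrow> 'c \<times> 'x \<Rightarrow> ('c \<times> 'x) set" where
  "cat_class C A p = cat_equiv C A `` {p}"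

definition cat_space :: "'c category \<Rightarrow> ('c, 'x) action \<Rightarrow> ('c \<times> 'x) set set" where
  "cat_space C A = cat_pairs C A // cat_equiv C A"

definition cat_adom :: "'c category \<Rightarrow> ('c, 'x) action \<Rightarrow> 'c \<Rightarrow> ('c \<times> 'x) set set" where
  "cat_adom C A g = cat_class C A `
     {p \<in> cat_pairs C A. \<exists>h' x'. (h', x') \<in> cat_pairs C A \<and> (g, h') \<in> composable C \<and>
        (p, (h', x')) \<in> cat_equiv C A}"

definition cat_act ::
    "'c category \<Rightarrow> ('c, 'x) action \<Rightarrow> 'c \<Rightarrow> ('c \<times> 'x) set \<Rightarrow> ('c \<times> 'x) set" where
  "cat_act C A g \<epsilon> = (THE \<epsilon>'.
     \<exists>p h' x'. p \<in> cat_pairs C A \<and> \<epsilon> = cat_class C A p \<and>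
       (h', x') \<in> cat_pairs C A \<and> (g, h') \<in> composable C \<and> (p, (h', x')) \<in> cat_equiv C A \<and>
       \<epsilon>' = cat_class C A (g \<cdot>\<^bsub>C\<^esub> h', x'))"

definition cat_globalization :: "'c category \<Rightarrow> ('c, 'x) action \<Rightarrow> ('c, ('c \<times> 'x) set) action" where
  "cat_globalization C A = \<lparr>space = cat_space C A, adom = cat_adom C A, act = cat_act C A\<rparr>"

definition cat_i :: "'c category \<Rightarrow> ('c, 'x) action \<Rightarrow> 'x \<Rightarrow> ('c \<times> 'x) set" where
  "cat_i C A x = cat_class C A ((SOME e. e \<in> Obj C \<and> x \<in> adom A e), x)"

end

theory Submission
  imports Defs
begin

text \<open>For a categorical partial action ${_{\rho_s}X}$ collapses to ${_{D(s)}X}$, so the symbol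
  \<open>\<delta>\<close> is redundant: \<open>(\<delta>, x)\<close> is equivalent to \<open>(e, x)\<close> for every object \<open>e\<close> with $x \in {_eX}$.
  Hence both globalizations are quotients of \<open>cat_pairs\<close> by the same equivalence relation, with
  \<open>s\<close> acting by \<open>[t, y] \<mapsto> [st, y]\<close> on the classes that contain some \<open>(t, y)\<close> with \<open>R(t) = D(s)\<close>.\<close>

section \<open>Generated equivalence relations and their invariants\<close>

lemma equiv_Times_self: "equiv S (S \<times> S)"
  by (auto intro!: equivI refl_onI symI transI)

lemma equiv_least_equiv:
  assumes "G \<subseteq> S \<times> S"
  shows "equiv S (least_equiv S G)"
proof -
  \<comment> \<open>Since \<open>G\<close> lies in \<open>S \<times> S\<close>, the full relation on
    \<open>S\<close> belongs to the intersected family; this bounds the intersection by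
    \<open>S \<times> S\<close>.\<close>
  have sub: "least_equiv S G \<subseteq> S \<times> S"
    using assms equiv_Times_self[of S] by (auto simp: least_equiv_def)
  show ?thesis
  proof (intro equivI refl_onI symI transI)
    show "least_equiv S G \<subseteq> S \<times> S" by (rule sub)
  next
    show "(x, x) \<in> least_equiv S G" if "x \<in> S" for x
      using that by (auto simp: least_equiv_def equiv_def refl_on_def)
  next
    show "(y, x) \<in> least_equiv S G" if "(x, y) \<in> least_equiv S G" for x y
      using that by (auto simp: least_equiv_def equiv_def dest: symD)
  next
    show "(x, z) \<in> least_equiv S G"
      if "(x, y) \<in> least_equiv S G" "(y, z) \<in> least_equiv S G" for x y z
      using that unfolding least_equiv_def equiv_def by (blast dest: transD)
  qed
qed

lemma least_equiv_generator: "p \<in> G \<Longrightarrow> p \<in> least_equiv S G"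
  by (auto simp: least_equiv_def)

text \<open>The kernel of \<open>f\<close> on \<open>S\<close> is an equivalence relation containing
  \<open>G\<close>, so it contains the least one. Every argument about chains of generators below is
  replaced by the choice of a suitable \<open>f\<close>.\<close>

lemma least_equiv_invariant:
  assumes pq: "(p, q) \<in> least_equiv S G" and G: "G \<subseteq> S \<times> S"
    and inv: "\<And>p q. (p, q) \<in> G \<Longrightarrow> f p = f q"
  shows "f p = f q"
proof -
  have "equiv S {(p, q). p \<in> S \<and> q \<in> S \<and> f p = f q}"
    by (auto intro!: equivI refl_onI symI transI)
  moreover have "G \<subseteq> {(p, q). p \<in> S \<and> q \<in> S \<and> f p = f q}"
    using G inv by blast
  ultimately have "least_equiv S G \<subseteq> {(p, q). p \<in> S \<and> q \<in> S \<and> f p = f q}"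
    unfolding least_equiv_def by (intro Inter_lower) simp
  then show ?thesis using pq by auto
qed

section \<open>Composability and the relation R' in a small category\<close>

context small_category
begin

lemma composable_iff: "(g, h) \<in> composable C \<longleftrightarrow> g \<in> Mor C \<and> h \<in> Mor C \<and> Dom C g = Rng C h"
  by (simp add: composable_def)

lemma right_mult_iff: "h \<in> right_mult C g \<longleftrightarrow> g \<in> Mor C \<and> h \<in> Mor C \<and> Dom C g = Rng C h"
  by (simp add: right_mult_def composable_iff)

lemma Dom_in_Mor: "g \<in> Mor C \<Longrightarrow> Dom C g \<in> Mor C"
  and Rng_in_Mor: "g \<in> Mor C \<Longrightarrow> Rng C g \<in> Mor C"
  using Dom_in Rng_in Obj_subset by blast+

lemma Rng_Dom: "g \<in> Mor C \<Longrightarrow> Rng C (Dom C g) = Dom C g"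
  and Dom_Dom: "g \<in> Mor C \<Longrightarrow> Dom C (Dom C g) = Dom C g"
  and Dom_Rng: "g \<in> Mor C \<Longrightarrow> Dom C (Rng C g) = Rng C g"
  by (simp_all add: Dom_in Rng_in Dom_Obj Rng_Obj)

lemma Dom_in_right_mult: "g \<in> Mor C \<Longrightarrow> Dom C g \<in> right_mult C g"
  by (simp add: right_mult_iff Dom_in_Mor Rng_Dom)

text \<open>The identity D(g) is itself in \<open>right_mult C g\<close>, and its range recovers the
  domain of any morphism that composes with it on the left.\<close>

lemma right_mult_eq_iff:
  assumes "g \<in> Mor C" "h \<in> Mor C"
  shows "right_mult C g = right_mult C h \<longleftrightarrow> Dom C g = Dom C h"
proof
  assume "right_mult C g = right_mult C h"
  then have "Dom C g \<in> right_mult C h" using Dom_in_right_mult assms(1) by auto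
  then show "Dom C g = Dom C h" using assms(1) by (simp add: right_mult_iff Rng_Dom)
next
  assume "Dom C g = Dom C h"
  then show "right_mult C g = right_mult C h" using assms by (auto simp: right_mult_iff)
qed

text \<open>Every generator preserves the domain. Conversely, morphisms with a common domain have
  the same \<open>right_mult\<close>, nonempty because of the identity, so they are already related
  by one generator.\<close>

lemma sg_rel_iff: "(s, t) \<in> sg_rel C \<longleftrightarrow> s \<in> Mor C \<and> t \<in> Mor C \<and> Dom C s = Dom C t"
proof -
  have G: "sg_gen C \<subseteq> Mor C \<times> Mor C" by (auto simp: sg_gen_def)
  show ?thesis
  proof
    assume st: "(s, t) \<in> sg_rel C"
    have "Dom C s = Dom C t"
    proof (rule least_equiv_invariant[OF st[unfolded sg_rel_def] G, of "Dom C"])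
      fix p q assume "(p, q) \<in> sg_gen C"
      then show "Dom C p = Dom C q"
        by (auto simp: sg_gen_def right_mult_eq_iff composable_iff Dom_Comp)
    qed
    moreover have "s \<in> Mor C" "t \<in> Mor C"
      using st equiv_type[OF equiv_least_equiv[OF G]] unfolding sg_rel_def by auto
    ultimately show "s \<in> Mor C \<and> t \<in> Mor C \<and> Dom C s = Dom C t" by blast
  next
    assume *: "s \<in> Mor C \<and> t \<in> Mor C \<and> Dom C s = Dom C t"
    then have "(s, t) \<in> sg_gen C"
      using right_mult_eq_iff[of s t] Dom_in_right_mult[of t] by (auto simp: sg_gen_def)
    then show "(s, t) \<in> sg_rel C" unfolding sg_rel_def by (rule least_equiv_generator)
  qed
qed

end

section \<open>Consequences of the categorical axioms\<close>

locale categorical_action = small_category C for C :: "'c category" (structure) +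
  fixes A :: "('c, 'x) action"
  assumes categorical: "categorical_partial_action C A"
begin

lemma partial: "partial_action C A"
  using categorical by (simp add: categorical_partial_action_def)

lemma adom_subset_space: "g \<in> Mor C \<Longrightarrow> x \<in> adom A g \<Longrightarrow> x \<in> space A"
  using partial by (auto simp: partial_action_def)

lemma act_Comp_iff:
  assumes "g \<in> Mor C" "h \<in> Mor C" "Dom C g = Rng C h" "x \<in> adom A h"
  shows "x \<in> adom A (g \<cdot> h) \<longleftrightarrow> act A h x \<in> adom A g"
proof -
  have "{x \<in> adom A h. act A h x \<in> adom A g \<inter> aran A h} = adom A h \<inter> adom A (g \<cdot> h)"
    using partial assms(1-3) composable_iff[of g h] unfolding partial_action_def by blast
  then show ?thesis using assms(4) by (auto simp: aran_def)
qed

lemma act_Comp: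
  assumes "g \<in> Mor C" "h \<in> Mor C" "Dom C g = Rng C h" "x \<in> adom A h" "x \<in> adom A (g \<cdot> h)"
  shows "act A (g \<cdot> h) x = act A g (act A h x)"
  using partial assms unfolding partial_action_def composable_def by fastforce

lemma act_Obj: "e \<in> Obj C \<Longrightarrow> x \<in> adom A e \<Longrightarrow> act A e x = x"
  using categorical by (simp add: categorical_partial_action_def)

lemma adom_subset_Dom: "g \<in> Mor C \<Longrightarrow> x \<in> adom A g \<Longrightarrow> x \<in> adom A (Dom C g)"
proof -
  assume g: "g \<in> Mor C" and x: "x \<in> adom A g"
  then have "(g, Dom C g) \<in> composable C" by (simp add: composable_iff Dom_in_Mor Rng_Dom)
  then have "adom A g \<subseteq> adom A (Dom C g)"
    using categorical Dom_in[OF g] unfolding categorical_partial_action_def by blast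
  then show ?thesis using x by blast
qed

text \<open>This is (P1) for the factorization of g as R(g) followed on the right by g.\<close>

lemma act_in_Rng: "g \<in> Mor C \<Longrightarrow> x \<in> adom A g \<Longrightarrow> act A g x \<in> adom A (Rng C g)"
  using act_Comp_iff[of "Rng C g" g x] by (simp add: Rng_in_Mor Dom_Rng Rng_Comp_self)

lemma space_covered:
  assumes "x \<in> space A"
  obtains e where "e \<in> Obj C" "x \<in> adom A e"
proof -
  from assms obtain g y where "g \<in> Mor C" "y \<in> adom A g" "x = act A g y"
    using categorical by (auto simp: categorical_partial_action_def aran_def)
  then show thesis using that[of "Rng C g"] act_in_Rng Rng_in by blast
qed

text \<open>Domains of R'-related morphisms lie in ${_{D(s)}X}$ by (C3), and ranges of morphisms
  ending at D(s) lie there by \<open>act_in_Rng\<close>. Equality is attained because D(s) is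
  R'-related to s.\<close>

lemma rho_dom_eq: "s \<in> Mor C \<Longrightarrow> rho_dom C A s = adom A (Dom C s)"
proof
  assume s: "s \<in> Mor C"
  show "rho_dom C A s \<subseteq> adom A (Dom C s)"
  proof
    fix x assume "x \<in> rho_dom C A s"
    then consider t where "(t, s) \<in> sg_rel C" "x \<in> adom A t"
      | t y where "t \<in> right_mult C s" "y \<in> adom A t" "x = act A t y"
      by (auto simp: rho_dom_def aran_def)
    then show "x \<in> adom A (Dom C s)"
    proof cases
      case 1
      then show ?thesis using adom_subset_Dom[of t x] by (auto simp: sg_rel_iff)
    next
      case 2
      then show ?thesis using act_in_Rng[of t y] by (auto simp: right_mult_iff)
    qed
  qed
  have "(Dom C s, s) \<in> sg_rel C" using s by (simp add: sg_rel_iff Dom_in_Mor Dom_Dom)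
  then show "adom A (Dom C s) \<subseteq> rho_dom C A s" by (auto simp: rho_dom_def)
qed

section \<open>Pairs and their classes in the two quotients\<close>

lemma cat_pairs_iff: "(g, x) \<in> cat_pairs C A \<longleftrightarrow> g \<in> Mor C \<and> x \<in> adom A (Dom C g)"
  by (simp add: cat_pairs_def)

lemma cat_pairs_Comp:
  "s \<in> Mor C \<Longrightarrow> (t, y) \<in> cat_pairs C A \<Longrightarrow> Dom C s = Rng C t \<Longrightarrow> (s \<cdot> t, y) \<in> cat_pairs C A"
  by (simp add: cat_pairs_iff Comp_in Dom_Comp)

lemma sg_pairs_iff:
  "(Some s, x) \<in> sg_pairs C A \<longleftrightarrow> (s, x) \<in> cat_pairs C A"
  "(None, x) \<in> sg_pairs C A \<longleftrightarrow> x \<in> space A"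
  by (auto simp: sg_pairs_def cat_pairs_iff rho_dom_eq)

lemma equiv_cat_equiv: "equiv (cat_pairs C A) (cat_equiv C A)"
  unfolding cat_equiv_def by (rule equiv_least_equiv) (auto simp: cat_equiv_gen_def)

lemma equiv_sg_approx: "equiv (sg_pairs C A) (sg_approx C A)"
  unfolding sg_approx_def by (rule equiv_least_equiv) (auto simp: sg_approx_gen_def)

lemma cat_class_eq_iff:
  "p \<in> cat_pairs C A \<Longrightarrow> q \<in> cat_pairs C A \<Longrightarrow>
    cat_class C A p = cat_class C A q \<longleftrightarrow> (p, q) \<in> cat_equiv C A"
  unfolding cat_class_def by (rule eq_equiv_class_iff[OF equiv_cat_equiv])

lemma sg_class_eq_iff:
  "p \<in> sg_pairs C A \<Longrightarrow> q \<in> sg_pairs C A \<Longrightarrow>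
    sg_class C A p = sg_class C A q \<longleftrightarrow> (p, q) \<in> sg_approx C A"
  unfolding sg_class_def by (rule eq_equiv_class_iff[OF equiv_sg_approx])

lemma cat_class_eqI: "(p, q) \<in> cat_equiv C A \<Longrightarrow> cat_class C A p = cat_class C A q"
  unfolding cat_class_def by (rule equiv_class_eq[OF equiv_cat_equiv])

lemma sg_class_eqI: "(p, q) \<in> sg_approx C A \<Longrightarrow> sg_class C A p = sg_class C A q"
  unfolding sg_class_def by (rule equiv_class_eq[OF equiv_sg_approx])

text \<open>This reduces invariance under the equivalence to its two sources: a right factor may be
  moved onto the point, and objects may be exchanged. With an equation as conclusion, symmetry and
  transitivity need no separate cases.\<close>

lemma cat_equiv_induct [consumes 1, case_names shift Obj]:
  assumes "(p, q) \<in> cat_equiv C A"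
    and "\<And>g h x. \<lbrakk>g \<in> Mor C; h \<in> Mor C; Dom C g = Rng C h; x \<in> adom A h\<rbrakk>
          \<Longrightarrow> f (g \<cdot> h, x) = f (g, act A h x)"
    and "\<And>e e' x. \<lbrakk>e \<in> Obj C; e' \<in> Obj C; x \<in> adom A e; x \<in> adom A e'\<rbrakk> \<Longrightarrow> f (e, x) = f (e', x)"
  shows "f p = f q"
proof (rule least_equiv_invariant[OF assms(1)[unfolded cat_equiv_def]])
  show "cat_equiv_gen C A \<subseteq> cat_pairs C A \<times> cat_pairs C A" by (auto simp: cat_equiv_gen_def)
next
  fix p q assume "(p, q) \<in> cat_equiv_gen C A"
  then show "f p = f q"
    unfolding cat_equiv_gen_def
    by (auto simp: composable_iff cat_pairs_iff Dom_Obj intro: assms(2,3))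
qed

lemma cat_class_shift:
  assumes "g \<in> Mor C" "h \<in> Mor C" "Dom C g = Rng C h" "x \<in> adom A h"
  shows "cat_class C A (g \<cdot> h, x) = cat_class C A (g, act A h x)"
proof (rule cat_class_eqI, unfold cat_equiv_def, rule least_equiv_generator)
  show "((g \<cdot> h, x), (g, act A h x)) \<in> cat_equiv_gen C A"
    using assms adom_subset_Dom[of h x] act_in_Rng[of h x]
    by (auto simp: cat_equiv_gen_def cat_pairs_iff Comp_in Dom_Comp composable_iff)
qed

lemma cat_class_Obj:
  assumes "e \<in> Obj C" "e' \<in> Obj C" "x \<in> adom A e" "x \<in> adom A e'"
  shows "cat_class C A (e, x) = cat_class C A (e', x)"
proof (rule cat_class_eqI, unfold cat_equiv_def, rule least_equiv_generator)
  show "((e, x), (e', x)) \<in> cat_equiv_gen C A"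
    using assms Obj_subset by (auto simp: cat_equiv_gen_def cat_pairs_iff Dom_Obj)
qed

lemma sg_class_shift:
  assumes "g \<in> Mor C" "h \<in> Mor C" "Dom C g = Rng C h" "x \<in> adom A h"
  shows "sg_class C A (Some (g \<cdot> h), x) = sg_class C A (Some g, act A h x)"
proof (rule sg_class_eqI, unfold sg_approx_def, rule least_equiv_generator)
  show "((Some (g \<cdot> h), x), (Some g, act A h x)) \<in> sg_approx_gen C A"
    using assms adom_subset_Dom[of h x] act_in_Rng[of h x]
    by (auto simp: sg_approx_gen_def sg_pairs_iff cat_pairs_iff Comp_in Dom_Comp right_mult_iff)
qed

text \<open>By (C2) the object \<open>e\<close> fixes \<open>x\<close>, so this is an instance of
  the generator relating \<delta> to a morphism.\<close>

lemma sg_class_None: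
  assumes "e \<in> Obj C" "x \<in> adom A e"
  shows "sg_class C A (None, x) = sg_class C A (Some e, x)"
proof (rule sg_class_eqI, unfold sg_approx_def, rule least_equiv_generator)
  have "e \<in> Mor C" using assms(1) Obj_subset by blast
  then show "((None, x), (Some e, x)) \<in> sg_approx_gen C A"
    using assms act_Obj[OF assms] adom_subset_space[of e x]
    by (auto simp: sg_approx_gen_def sg_pairs_iff cat_pairs_iff Dom_Obj)
qed

lemma cat_i_eq:
  assumes "e \<in> Obj C" "x \<in> adom A e"
  shows "cat_i C A x = cat_class C A (e, x)"
proof -
  have "(SOME e. e \<in> Obj C \<and> x \<in> adom A e) \<in> Obj C \<and>
      x \<in> adom A (SOME e. e \<in> Obj C \<and> x \<in> adom A e)"
    by (rule someI[of _ e]) (simp add: assms)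
  then show ?thesis unfolding cat_i_def using assms by (intro cat_class_Obj) auto
qed

section \<open>Agreement of the two equivalence relations; left multiplication\<close>

lemma sg_class_eq_cat_class_eq:
  assumes "(t, y) \<in> cat_pairs C A" "(t', y') \<in> cat_pairs C A"
  shows "sg_class C A (Some t, y) = sg_class C A (Some t', y')
    \<longleftrightarrow> cat_class C A (t, y) = cat_class C A (t', y')"
proof
  \<comment> \<open>The class map of the category construction is extended to \<delta> by i, which
    makes it an invariant of the semigroupoid relation.\<close>
  define f where "f = (\<lambda>(a, x). case a of None \<Rightarrow> cat_i C A x | Some s \<Rightarrow> cat_class C A (s, x))"
  assume "sg_class C A (Some t, y) = sg_class C A (Some t', y')"
  then have "((Some t, y), (Some t', y')) \<in> sg_approx C A"
    using assms by (simp add: sg_class_eq_iff sg_pairs_iff)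
  then have "f (Some t, y) = f (Some t', y')"
    unfolding sg_approx_def
  proof (rule least_equiv_invariant)
    show "sg_approx_gen C A \<subseteq> sg_pairs C A \<times> sg_pairs C A" by (auto simp: sg_approx_gen_def)
  next
    \<comment> \<open>Writing s as R(s) times s, the shift turns [s, x] into [R(s), \<alpha>_s(x)],
      and the latter is i(\<alpha>_s(x)).\<close>
    have "cat_i C A (act A s x) = cat_class C A (s, x)" if "s \<in> Mor C" "x \<in> adom A s" for s x
      using that cat_class_shift[of "Rng C s" s x] cat_i_eq[of "Rng C s" "act A s x"]
      by (simp add: Rng_in Rng_in_Mor Dom_Rng Rng_Comp_self act_in_Rng)
    then show "f p = f q" if "(p, q) \<in> sg_approx_gen C A" for p q
      using that by (auto simp: f_def sg_approx_gen_def right_mult_iff cat_class_shift)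
  qed
  then show "cat_class C A (t, y) = cat_class C A (t', y')" by (simp add: f_def)
next
  assume "cat_class C A (t, y) = cat_class C A (t', y')"
  then have "((t, y), (t', y')) \<in> cat_equiv C A"
    using assms by (simp add: cat_class_eq_iff)
  then have "(\<lambda>(s, x). sg_class C A (Some s, x)) (t, y) = (\<lambda>(s, x). sg_class C A (Some s, x)) (t', y')"
  proof (induction rule: cat_equiv_induct)
    case (shift g h x)
    then show ?case by (simp add: sg_class_shift)
  next
    case (Obj e e' x)
    \<comment> \<open>An exchange of objects is a passage through (\<delta>, x).\<close>
    then show ?case using sg_class_None[of e x] sg_class_None[of e' x] by simp
  qed
  then show "sg_class C A (Some t, y) = sg_class C A (Some t', y')" by simp
qed

text \<open>A chain of generators between two pairs on which \<open>s\<close> can be multiplied may leave the set of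
  such pairs, since objects can be exchanged. The function \<open>f\<close> below extends \<open>(t, y) \<mapsto> [st, y]\<close>
  to an invariant of all pairs: an intermediate pair \<open>(t, y)\<close> with \<open>R(t) \<noteq> D(s)\<close> can contribute
  only through the point \<open>\<alpha>\<^sub>t(y)\<close> of \<open>X\<close>.\<close>

lemma cat_class_Comp_cong:
  assumes eq: "cat_class C A (t, y) = cat_class C A (t', y')"
    and t: "(t, y) \<in> cat_pairs C A" "(t', y') \<in> cat_pairs C A"
    and s: "s \<in> Mor C" "Dom C s = Rng C t" "Dom C s = Rng C t'"
  shows "cat_class C A (s \<cdot> t, y) = cat_class C A (s \<cdot> t', y')"
proof -
  define f where "f = (\<lambda>(h, x). if Rng C h = Dom C s then Some (cat_class C A (s \<cdot> h, x))
    else if x \<in> adom A h \<and> act A h x \<in> adom A (Dom C s) then Some (cat_class C A (s, act A h x))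
    else None)"
  have "((t, y), (t', y')) \<in> cat_equiv C A" using eq t by (simp add: cat_class_eq_iff)
  then have "f (t, y) = f (t', y')"
  proof (induction rule: cat_equiv_induct)
    case (shift g h x)
    show ?case
    proof (cases "Rng C g = Dom C s")
      case True
      then show ?thesis using shift s cat_class_shift[of "s \<cdot> g" h x]
        by (simp add: f_def Rng_Comp Comp_in Dom_Comp Comp_assoc)
    next
      case False
      \<comment> \<open>By (P1) and (P2) both pairs satisfy the same membership tests and yield the
        same point of X.\<close>
      then show ?thesis using shift act_Comp_iff[of g h x] act_Comp[of g h x]
        by (auto simp: f_def Rng_Comp)
    qed
  next
    case (Obj e e' x)
    \<comment> \<open>If e = D(s), the first branch gives [s e, x] = [s, x]; otherwise \<alpha>_e
      fixes x. The common value does not mention \<open>e\<close>.\<close>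
    have "f (e, x) = (if x \<in> adom A (Dom C s) then Some (cat_class C A (s, x)) else None)"
      if "e \<in> Obj C" "x \<in> adom A e" for e
      using that s(1) Comp_Dom[OF s(1)] by (auto simp: f_def Rng_Obj act_Obj)
    then show ?case using Obj by simp
  qed
  then show ?thesis using s by (simp add: f_def)
qed

section \<open>Actions presented as quotients of the set of pairs\<close>

text \<open>This isolates what the two globalizations share, so that the action axioms and the
  isomorphism are proved once for an arbitrary class map \<open>cl\<close>. That left multiplication
  respects classes is implicit, because \<open>act B s\<close> takes the class as its
  argument.\<close>

definition presents :: "('c \<times> 'x \<Rightarrow> 'y) \<Rightarrow> ('c, 'y) action \<Rightarrow> bool" where
  "presents cl B \<longleftrightarrow> space B = cl ` cat_pairs C A \<and>
     (\<forall>s\<in>Mor C. adom B s = cl ` {(t, y) \<in> cat_pairs C A. Rng C t = Dom C s} \<and>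
       (\<forall>(t, y)\<in>cat_pairs C A. Rng C t = Dom C s \<longrightarrow> act B s (cl (t, y)) = cl (s \<cdot> t, y)))"

lemma presents_space: "presents cl B \<Longrightarrow> space B = cl ` cat_pairs C A"
  by (simp add: presents_def)

lemma presents_adom:
  "presents cl B \<Longrightarrow> s \<in> Mor C \<Longrightarrow>
    adom B s = cl ` {(t, y) \<in> cat_pairs C A. Rng C t = Dom C s}"
  by (simp add: presents_def)

lemma presents_act:
  "presents cl B \<Longrightarrow> s \<in> Mor C \<Longrightarrow> (t, y) \<in> cat_pairs C A \<Longrightarrow> Rng C t = Dom C s \<Longrightarrow>
    act B s (cl (t, y)) = cl (s \<cdot> t, y)"
  by (auto simp: presents_def)

lemma presents_adomE:
  assumes "presents cl B" "s \<in> Mor C" "\<epsilon> \<in> adom B s"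
  obtains t y where "(t, y) \<in> cat_pairs C A" "Rng C t = Dom C s" "\<epsilon> = cl (t, y)"
  using assms by (auto simp: presents_adom)

lemma presents_adomI:
  "presents cl B \<Longrightarrow> s \<in> Mor C \<Longrightarrow> (t, y) \<in> cat_pairs C A \<Longrightarrow> Rng C t = Dom C s \<Longrightarrow>
    cl (t, y) \<in> adom B s"
  by (auto simp: presents_adom)

text \<open>The domain of s depends only on D(s), which gives (G1) and (G2). Since R(ht) = R(h), a
  class in the domain of h is sent into the domain of g, and (P2) becomes associativity.\<close>

lemma presents_global_action:
  assumes B: "presents cl B"
  shows "global_action C B"
proof -
  have adom_cong: "adom B g = adom B h" if "g \<in> Mor C" "h \<in> Mor C" "Dom C g = Dom C h" for g h
    using that by (simp add: presents_adom[OF B])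
  have act_adom: "act B h \<epsilon> \<in> adom B g \<and> act B g (act B h \<epsilon>) = act B (g \<cdot> h) \<epsilon>"
    if gh: "g \<in> Mor C" "h \<in> Mor C" "Dom C g = Rng C h" and \<epsilon>: "\<epsilon> \<in> adom B h" for g h \<epsilon>
  proof -
    obtain t y where t: "(t, y) \<in> cat_pairs C A" "Rng C t = Dom C h" "\<epsilon> = cl (t, y)"
      using presents_adomE[OF B gh(2) \<epsilon>] .
    then have "t \<in> Mor C" by (simp add: cat_pairs_iff)
    then show ?thesis
      using t gh cat_pairs_Comp[of h t y]
      by (simp add: presents_act[OF B] presents_adomI[OF B] Rng_Comp Dom_Comp Comp_in Comp_assoc)
  qed
  have adom_space: "adom B g \<subseteq> space B" if "g \<in> Mor C" for g
    using that by (auto simp: presents_adom[OF B] presents_space[OF B])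
  have aran_space: "aran B g \<subseteq> space B" if g: "g \<in> Mor C" for g
  proof
    fix \<epsilon> assume "\<epsilon> \<in> aran B g"
    then obtain \<epsilon>' where \<epsilon>': "\<epsilon>' \<in> adom B g" "\<epsilon> = act B g \<epsilon>'" by (auto simp: aran_def)
    obtain t y where "(t, y) \<in> cat_pairs C A" "Rng C t = Dom C g" "\<epsilon>' = cl (t, y)"
      using presents_adomE[OF B g \<epsilon>'(1)] .
    then show "\<epsilon> \<in> space B"
      using \<epsilon>'(2) g cat_pairs_Comp[of g t y]
      by (simp add: presents_act[OF B] presents_space[OF B])
  qed
  have G2: "adom B h = adom B (g \<cdot> h)" if "(g, h) \<in> composable C" for g h
    using that by (intro adom_cong) (auto simp: composable_iff Comp_in Dom_Comp)
  \<comment> \<open>By (G2) both sides are all of \<open>adom B h\<close>.\<close>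
  have P1: "{\<epsilon> \<in> adom B h. act B h \<epsilon> \<in> adom B g \<inter> aran B h} = adom B h \<inter> adom B (g \<cdot> h)"
    if "(g, h) \<in> composable C" for g h
    using that act_adom[of g h] G2[OF that] by (auto simp: composable_iff aran_def)
  have P2: "act B g (act B h \<epsilon>) = act B (g \<cdot> h) \<epsilon>"
    if "(g, h) \<in> composable C" "\<epsilon> \<in> adom B h \<inter> adom B (g \<cdot> h)" for g h \<epsilon>
    using that act_adom by (simp add: composable_iff)
  have G1: "adom B g = adom B h"
    if "g \<in> Mor C" "h \<in> Mor C" "right_mult C g = right_mult C h \<and> right_mult C h \<noteq> {}" for g h
    using that adom_cong right_mult_eq_iff by blast
  show ?thesis
    unfolding global_action_def partial_action_def
    by (intro conjI ballI impI case_prodI2; (hypsubst)?)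
      (erule adom_space aran_space P1 G2 | rule P2 G1, assumption+)+
qed

lemma presents_morphism:
  assumes B: "presents cl B" and B': "presents cl' B'"
    and \<phi>: "\<And>p. p \<in> cat_pairs C A \<Longrightarrow> \<phi> (cl p) = cl' p"
  shows "action_morphism C B B' \<phi>"
proof -
  have "\<phi> \<epsilon> \<in> adom B' g \<and> \<phi> (act B g \<epsilon>) = act B' g (\<phi> \<epsilon>)" if g: "g \<in> Mor C" "\<epsilon> \<in> adom B g" for g \<epsilon>
  proof -
    obtain t y where "(t, y) \<in> cat_pairs C A" "Rng C t = Dom C g" "\<epsilon> = cl (t, y)"
      using presents_adomE[OF B g] .
    then show ?thesis using g cat_pairs_Comp[of g t y]
      by (simp add: \<phi> presents_adomI[OF B'] presents_act[OF B] presents_act[OF B'])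
  qed
  moreover have "\<phi> ` space B \<subseteq> space B'"
    by (auto simp: \<phi> presents_space[OF B] presents_space[OF B'])
  ultimately show ?thesis unfolding action_morphism_def by blast
qed

text \<open>Class maps with equal kernels induce mutually inverse maps between their images, sending
  \<open>cl p\<close> to \<open>cl' p\<close> and back; \<open>inv_into\<close> picks the
  representative, and \<open>ker\<close> makes the choice harmless.\<close>

lemma presents_isomorphic:
  assumes B: "presents cl B" and B': "presents cl' B'"
    and ker: "\<And>p q. p \<in> cat_pairs C A \<Longrightarrow> q \<in> cat_pairs C A \<Longrightarrow> cl p = cl q \<longleftrightarrow> cl' p = cl' q"
  shows "isomorphic_global_actions C B B'"
proof -
  let ?P = "cat_pairs C A"
  define \<phi> where "\<phi> = (\<lambda>\<epsilon>. cl' (inv_into ?P cl \<epsilon>))"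
  define \<psi> where "\<psi> = (\<lambda>\<epsilon>. cl (inv_into ?P cl' \<epsilon>))"
  have \<phi>: "\<phi> (cl p) = cl' p" if "p \<in> ?P" for p
    using that ker[of "inv_into ?P cl (cl p)" p]
    by (auto simp: \<phi>_def inv_into_into f_inv_into_f)
  have \<psi>: "\<psi> (cl' p) = cl p" if "p \<in> ?P" for p
    using that ker[of "inv_into ?P cl' (cl' p)" p]
    by (auto simp: \<psi>_def inv_into_into f_inv_into_f)
  have "action_morphism C B B' \<phi>" "action_morphism C B' B \<psi>"
    using presents_morphism[OF B B' \<phi>] presents_morphism[OF B' B \<psi>] by blast+
  moreover have "\<forall>\<epsilon>\<in>space B. \<psi> (\<phi> \<epsilon>) = \<epsilon>" "\<forall>\<epsilon>\<in>space B'. \<phi> (\<psi> \<epsilon>) = \<epsilon>"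
    by (auto simp: presents_space[OF B] presents_space[OF B'] \<phi> \<psi>)
  ultimately show ?thesis
    unfolding isomorphic_global_actions_def
    using presents_global_action[OF B] presents_global_action[OF B'] by blast
qed

section \<open>Both globalizations are presented by pairs\<close>

lemma presents_cat_globalization: "presents (cat_class C A) (cat_globalization C A)"
proof -
  have "cat_adom C A s = cat_class C A ` {(t, y) \<in> cat_pairs C A. Rng C t = Dom C s}"
    if "s \<in> Mor C" for s
  proof
    show "cat_adom C A s \<subseteq> cat_class C A ` {(t, y) \<in> cat_pairs C A. Rng C t = Dom C s}"
      unfolding cat_adom_def by (force simp: composable_iff dest: cat_class_eqI)
    show "cat_class C A ` {(t, y) \<in> cat_pairs C A. Rng C t = Dom C s} \<subseteq> cat_adom C A s"
      unfolding cat_adom_def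
    proof (rule image_mono, clarify)
      fix t y assume t: "(t, y) \<in> cat_pairs C A" "Rng C t = Dom C s"
      \<comment> \<open>Reflexivity is read off from the trivial equality of classes.\<close>
      then have "((t, y), (t, y)) \<in> cat_equiv C A" by (simp flip: cat_class_eq_iff)
      then show "\<exists>h' x'. (h', x') \<in> cat_pairs C A \<and> (s, h') \<in> composable C \<and>
          ((t, y), (h', x')) \<in> cat_equiv C A"
        using t that by (intro exI[of _ t] exI[of _ y]) (simp add: composable_iff cat_pairs_iff)
    qed
  qed
  moreover have "cat_act C A s (cat_class C A (t, y)) = cat_class C A (s \<cdot> t, y)"
    if s: "s \<in> Mor C" and t: "(t, y) \<in> cat_pairs C A" "Rng C t = Dom C s" for s t y
    unfolding cat_act_def
  proof (rule the_equality)
    have "((t, y), (t, y)) \<in> cat_equiv C A" "t \<in> Mor C"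
      using t by (simp_all add: cat_pairs_iff flip: cat_class_eq_iff)
    then show "\<exists>p h' x'. p \<in> cat_pairs C A \<and> cat_class C A (t, y) = cat_class C A p \<and>
        (h', x') \<in> cat_pairs C A \<and> (s, h') \<in> composable C \<and> (p, (h', x')) \<in> cat_equiv C A \<and>
        cat_class C A (s \<cdot> t, y) = cat_class C A (s \<cdot> h', x')"
      using s t
      by (intro exI[of _ "(t, y)"] exI[of _ t] exI[of _ y]) (simp add: composable_iff)
  next
    fix \<epsilon> assume "\<exists>p h' x'. p \<in> cat_pairs C A \<and> cat_class C A (t, y) = cat_class C A p \<and>
        (h', x') \<in> cat_pairs C A \<and> (s, h') \<in> composable C \<and> (p, (h', x')) \<in> cat_equiv C A \<and>
        \<epsilon> = cat_class C A (s \<cdot> h', x')"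
    then obtain p h' x' where *: "cat_class C A (t, y) = cat_class C A p"
        "(h', x') \<in> cat_pairs C A" "(s, h') \<in> composable C" "(p, (h', x')) \<in> cat_equiv C A"
        "\<epsilon> = cat_class C A (s \<cdot> h', x')"
      by blast
    \<comment> \<open>Any admissible representative lies in the class of (t, y), so
      \<open>cat_class_Comp_cong\<close> gives the uniqueness required by the definite
      description.\<close>
    then have "cat_class C A (t, y) = cat_class C A (h', x')" using cat_class_eqI by simp
    then show "\<epsilon> = cat_class C A (s \<cdot> t, y)"
      using * s t cat_class_Comp_cong[of t y h' x' s] by (simp add: composable_iff)
  qed
  moreover have "cat_space C A = cat_class C A ` cat_pairs C A"
    by (auto simp: cat_space_def quotient_def cat_class_def)
  ultimately show ?thesis by (auto simp: presents_def cat_globalization_def)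
qed

lemma presents_sg_globalization:
  "presents (\<lambda>(t, y). sg_class C A (Some t, y)) (sg_globalization C A)"
proof -
  let ?cl = "\<lambda>(t, y). sg_class C A (Some t, y)"
  have None_eq: "sg_class C A (None, x) = sg_class C A (Some (Dom C s), x)"
    and Dom_pair: "(Dom C s, x) \<in> cat_pairs C A"
    if "s \<in> Mor C" "x \<in> rho_dom C A s" for s x
    using that sg_class_None[of "Dom C s" x]
    by (simp_all add: rho_dom_eq Dom_in cat_pairs_iff Dom_in_Mor Dom_Dom)
  have "sg_adom C A s = ?cl ` {(t, y) \<in> cat_pairs C A. Rng C t = Dom C s}"
    if s: "s \<in> Mor C" for s
  proof
    show "sg_adom C A s \<subseteq> ?cl ` {(t, y) \<in> cat_pairs C A. Rng C t = Dom C s}"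
    proof
      fix \<epsilon> assume "\<epsilon> \<in> sg_adom C A s"
      then consider p t y where "(Some t, y) \<in> sg_pairs C A" "t \<in> right_mult C s"
          "(p, (Some t, y)) \<in> sg_approx C A" "\<epsilon> = sg_class C A p"
        | x where "x \<in> rho_dom C A s" "\<epsilon> = sg_class C A (None, x)"
        unfolding sg_adom_def by blast
      then obtain t y where "(t, y) \<in> cat_pairs C A" "Rng C t = Dom C s" "\<epsilon> = ?cl (t, y)"
      proof cases
        case 1
        then show thesis using that[of t y] sg_class_eqI[of p "(Some t, y)"]
          by (simp add: sg_pairs_iff right_mult_iff)
      next
        case 2
        then show thesis using that[of "Dom C s" x] None_eq[OF s] Dom_pair[OF s] Rng_Dom[OF s]
          by simp
      qed
      then show "\<epsilon> \<in> ?cl ` {(t, y) \<in> cat_pairs C A. Rng C t = Dom C s}" by force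
    qed
    show "?cl ` {(t, y) \<in> cat_pairs C A. Rng C t = Dom C s} \<subseteq> sg_adom C A s"
    proof clarify
      fix t y assume t: "(t, y) \<in> cat_pairs C A" "Rng C t = Dom C s"
      then have "(Some t, y) \<in> sg_pairs C A" "((Some t, y), (Some t, y)) \<in> sg_approx C A"
        "t \<in> right_mult C s"
        using s by (simp_all add: sg_pairs_iff right_mult_iff cat_pairs_iff flip: sg_class_eq_iff)
      then show "sg_class C A (Some t, y) \<in> sg_adom C A s"
        unfolding sg_adom_def by blast
    qed
  qed
  moreover have "sg_act C A s (sg_class C A (Some t, y)) = sg_class C A (Some (s \<cdot> t), y)"
    if s: "s \<in> Mor C" and t: "(t, y) \<in> cat_pairs C A" "Rng C t = Dom C s" for s t y
  proof -
    \<comment> \<open>Well-definedness is transferred from the category construction, since the two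
      class maps have the same kernel.\<close>
    have cong: "sg_class C A (Some (s \<cdot> t'), y') = sg_class C A (Some (s \<cdot> t), y)"
      if "sg_class C A (Some t, y) = sg_class C A (Some t', y')"
        "(t', y') \<in> cat_pairs C A" "Rng C t' = Dom C s" for t' y'
    proof -
      have "cat_class C A (t, y) = cat_class C A (t', y')"
        using that t sg_class_eq_cat_class_eq by blast
      then have "cat_class C A (s \<cdot> t, y) = cat_class C A (s \<cdot> t', y')"
        by (rule cat_class_Comp_cong) (use that s t in simp_all)
      moreover have "(s \<cdot> t, y) \<in> cat_pairs C A" "(s \<cdot> t', y') \<in> cat_pairs C A"
        using that s t by (simp_all add: cat_pairs_Comp)
      ultimately show ?thesis using sg_class_eq_cat_class_eq by metis
    qed
    have refl: "((Some t, y), (Some t, y)) \<in> sg_approx C A" "t \<in> right_mult C s"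
      using s t by (simp_all add: sg_pairs_iff right_mult_iff cat_pairs_iff flip: sg_class_eq_iff)
    show ?thesis
      unfolding sg_act_def
    proof (rule the_equality, goal_cases)
      case 1
      show ?case
        by (rule disjI1, intro exI[of _ "(Some t, y)"] exI[of _ t] exI[of _ y])
          (use t refl in \<open>simp add: sg_pairs_iff\<close>)
    next
      case (2 \<epsilon>)
      then show ?case
      proof (elim disjE exE bexE conjE, goal_cases)
        case (1 p t' y')
        then have "sg_class C A (Some t, y) = sg_class C A (Some t', y')"
          using sg_class_eqI[of p "(Some t', y')"] by simp
        then show ?case using 1 cong by (simp add: sg_pairs_iff right_mult_iff)
      next
        \<comment> \<open>Here the representative is (D(s), x), and s D(s) = s matches the value
          prescribed for \<delta>.\<close>
        case (2 x)
        then show ?case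
          using cong[of "Dom C s" x] None_eq[OF s] Dom_pair[OF s] Rng_Dom[OF s] Comp_Dom[OF s]
          by simp
      qed
    qed
  qed
  moreover have "sg_space C A = ?cl ` cat_pairs C A"
  proof -
    have "sg_space C A = sg_class C A ` sg_pairs C A"
      by (auto simp: sg_space_def quotient_def sg_class_def)
    also have "\<dots> = ?cl ` cat_pairs C A"
    proof
      show "sg_class C A ` sg_pairs C A \<subseteq> ?cl ` cat_pairs C A"
      proof clarify
        fix a x assume a: "(a, x) \<in> sg_pairs C A"
        show "sg_class C A (a, x) \<in> ?cl ` cat_pairs C A"
        proof (cases a)
          case None
          \<comment> \<open>By (C1) every point of X lies in the domain of some object, so no class
            consists of \<delta> pairs alone.\<close>
          then obtain e where e: "e \<in> Obj C" "x \<in> adom A e"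
            using a space_covered by (auto simp: sg_pairs_iff)
          then have "(e, x) \<in> cat_pairs C A" using Obj_subset by (auto simp: cat_pairs_iff Dom_Obj)
          then show ?thesis using sg_class_None[OF e] None by force
        next
          case (Some s)
          then show ?thesis using a by (force simp: sg_pairs_iff)
        qed
      qed
      show "?cl ` cat_pairs C A \<subseteq> sg_class C A ` sg_pairs C A"
        by (auto simp: sg_pairs_iff)
    qed
    finally show ?thesis .
  qed
  ultimately show ?thesis by (auto simp: presents_def sg_globalization_def)
qed

end

theorem corollary4p14:
  fixes C :: "'c category" and \<alpha> :: "('c, 'x) action"
  assumes "small_category C"
    and "categorical_partial_action C \<alpha>"
  shows "isomorphic_global_actions C (sg_globalization C \<alpha>) (cat_globalization C \<alpha>)"
proof -
  interpret categorical_action C \<alpha>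
    using assms by (simp add: categorical_action_def categorical_action_axioms_def)
  show ?thesis
    by (rule presents_isomorphic[OF presents_sg_globalization presents_cat_globalization])
      (clarsimp simp: sg_class_eq_cat_class_eq)
qed

end
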